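(* Let $r\ge 1$ be an integer and let $p_1,\dots,p_{r+1}$ be the first $r+1$ prime numbers, where $p_i$ is the $i$-th prime. For $i=2,\dots,r$ let $(x'_i,t'_i)$ be any integer solution of the linear equation $$p_i x_i - t_i\prod_{k=1}^{i-1}p_k = 1 .$$ For $t\in\mathbb{Z}$ and $h_i\in\{1,2,\dots,p_i-1\}$ ($2\le i\le r$) define, if $r\ge 3$, $$Z_r(t,h_i)= t\prod_{l=1}^{r}p_l+(p_r x'_r-1)(h_r-1)+\sum_{j=2}^{r-1}\Big[(p_jx'_j-1)(h_j-1)\prod_{q=j+1}^{r}p_q x'_q\Big]-1,$$ and for $r=1,2$ $$Z_1(t,h_i)=2t+1,\qquad Z_2(t,h_i)=6t+4h_2+3 .$$ Then the set of values of $Z_r(t,h_i)$, as $t$ ranges over $\mathbb{Z}$ and each $h_i$ over $\{1,\dots,p_i-1\}$, that satisfy $$p_{r+1}\le Z_r(t,h_i)<p_{r+1}^{2}$$ is exactly the set of all prime numbers $p$ with $p_{r+1}\le p<p_{r+1}^{2}$.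
   Context: The notation $Z_r(t,h_i)$ stands for a function of $t$ and of the whole tuple $(h_2,\dots,h_r)$. *)

theory Defs
  imports
    Complex_Main
    "HOL-Library.Infinite_Set"
    "HOL-Computational_Algebra.Primes"
begin

text \<open>Primes are numbered from 1, whereas \<open>enumerate\<close> counts from 0; the value at
  index 0 is meaningless.\<close>

definition nth_prime :: "nat \<Rightarrow> int" where
  "nth_prime i = int (enumerate {q :: nat. prime q} (i - 1))"

text \<open>The argument \<open>x i\<close> is the first component of the chosen solution of
  \<open>p\<^sub>i x\<^sub>i - t\<^sub>i p\<^sub>1 \<dots> p\<^sub>i\<^sub>-\<^sub>1 = 1\<close>, and \<open>h\<close> is the tuple of parameters; only the entries
  with index between 2 and \<open>r\<close> are used. The value at \<open>r = 0\<close> is meaningless.\<close>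

definition Z :: "nat \<Rightarrow> (nat \<Rightarrow> int) \<Rightarrow> int \<Rightarrow> (nat \<Rightarrow> int) \<Rightarrow> int" where
  "Z r x t h =
    (if r = 1 then 2 * t + 1
     else if r = 2 then 6 * t + 4 * h 2 + 3
     else t * (\<Prod>l = 1..r. nth_prime l)
          + (nth_prime r * x r - 1) * (h r - 1)
          + (\<Sum>j = 2..r - 1. (nth_prime j * x j - 1) * (h j - 1)
                               * (\<Prod>q = j + 1..r. nth_prime q * x q))
          - 1)"

end

theory Submission
  imports Defs "HOL-Number_Theory.Cong"
begin

text \<open>The theorem rests on one fact: as \<open>t\<close> and \<open>h\<close> vary, \<open>Z r x' t h\<close> runs through exactly the
  integers that are divisible by none of the first \<open>r\<close> primes (\<open>Z_values\<close>).  An integer between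
  \<open>p\<^sub>r\<^sub>+\<^sub>1\<close> and its square is prime if and only if it has this property, because a composite number
  has a prime factor not exceeding its square root (\<open>prime_iff_no_small_prime_dvd\<close>).

  For \<open>r \<ge> 3\<close> the fact is an explicit Chinese remainder theorem.  The number \<open>e\<^sub>j = p\<^sub>j x'\<^sub>j\<close> is
  \<open>0\<close> modulo \<open>p\<^sub>j\<close> and \<open>1\<close> modulo each earlier prime.  Therefore the weight
  \<open>(e\<^sub>j - 1) e\<^sub>j\<^sub>+\<^sub>1 \<dots> e\<^sub>r\<close> of \<open>h\<^sub>j - 1\<close> is divisible by the primes before \<open>p\<^sub>j\<close>, owing to its first
  factor, and by the primes after \<open>p\<^sub>j\<close> up to \<open>p\<^sub>r\<close>, owing to the later \<open>e\<^sub>q\<close>; modulo \<open>p\<^sub>j\<close> it is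
  \<open>-1\<close>.  So \<open>Z r x' t h\<close> is \<open>-h\<^sub>i\<close> modulo \<open>p\<^sub>i\<close> for \<open>i \<ge> 2\<close> and is odd (\<open>Z_cong\<close>).  As \<open>h\<^sub>i\<close>
  ranges over \<open>1, \<dots>, p\<^sub>i - 1\<close>, every combination of nonzero residues occurs; two integers with the
  same residues differ by a multiple of \<open>p\<^sub>1 \<dots> p\<^sub>r\<close>, which the term with \<open>t\<close> supplies.  The
  linear forms for \<open>r = 1\<close> and \<open>r = 2\<close> are checked modulo 2 and modulo 6.\<close>

section \<open>The sequence of primes\<close>

lemma prime_nth_prime: "prime (nth_prime i)"
  using enumerate_in_set[OF primes_infinite, of "i - 1"] by (simp add: nth_prime_def)

lemma nth_prime_less:
  assumes "1 \<le> i" "i < j"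
  shows "nth_prime i < nth_prime j"
  using assms enumerate_mono[OF _ primes_infinite, of "i - 1" "j - 1"]
  by (simp add: nth_prime_def)

lemma coprime_nth_prime:
  assumes "1 \<le> i" "1 \<le> j" "i \<noteq> j"
  shows "coprime (nth_prime i) (nth_prime j)"
proof (rule primes_coprime[OF prime_nth_prime prime_nth_prime])
  show "nth_prime i \<noteq> nth_prime j"
    using assms nth_prime_less[of i j] nth_prime_less[of j i] by (cases "i < j") auto
qed

lemma prime_below_nth_prime:
  fixes q :: int
  assumes "prime q" "q < nth_prime (r + 1)"
  obtains i where "i \<in> {1..r}" "nth_prime i = q"
proof -
  have "prime (nat q)" using assms(1) prime_int_nat_transfer by blast
  then obtain n where n: "enumerate {q :: nat. prime q} n = nat q"
    using enumerate_Ex[OF primes_infinite] by blast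
  have q: "nth_prime (n + 1) = q"
    using n prime_gt_0_int[OF assms(1)] by (simp add: nth_prime_def)
  have "n < r"
  proof (rule ccontr)
    assume "\<not> n < r"
    then have "nth_prime (r + 1) \<le> nth_prime (n + 1)"
      using nth_prime_less[of "r + 1" "n + 1"] by (cases "r = n") auto
    then show False using assms(2) q by simp
  qed
  then show thesis using that[of "n + 1"] q by simp
qed

lemma nth_prime_1: "nth_prime 1 = 2"
proof -
  have "nth_prime 1 \<le> 2"
  proof (rule ccontr)
    assume "\<not> nth_prime 1 \<le> 2"
    then obtain i where "i \<in> {1..0::nat}"
      using prime_below_nth_prime[of 2 0] by auto
    then show False by simp
  qed
  then show ?thesis using prime_ge_2_int[OF prime_nth_prime[of 1]] by simp
qed

lemma nth_prime_2: "nth_prime 2 = 3"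
proof -
  have "nth_prime 2 \<le> 3"
  proof (rule ccontr)
    assume "\<not> nth_prime 2 \<le> 3"
    then have "3 < nth_prime (1 + 1)" by (simp add: one_add_one del: One_nat_def)
    moreover have "prime (3 :: int)" by simp
    ultimately obtain i where "i \<in> {1..1::nat}" "nth_prime i = 3"
      using prime_below_nth_prime by metis
    then show False using nth_prime_1 by simp
  qed
  then show ?thesis using nth_prime_less[of 1 2] nth_prime_1 by simp
qed

lemma prod_nth_prime_dvd:
  assumes "finite A" "0 \<notin> A" "\<And>i. i \<in> A \<Longrightarrow> nth_prime i dvd z"
  shows "(\<Prod>i\<in>A. nth_prime i) dvd z"
  using assms
proof (induction A rule: finite_induct)
  case (insert i A)
  have "coprime (nth_prime i) (nth_prime j)" if "j \<in> A" for j
    using that insert.hyps insert.prems(1)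
    by (intro coprime_nth_prime) (auto simp: Suc_le_eq intro: gr0I)
  then have "coprime (nth_prime i) (\<Prod>j\<in>A. nth_prime j)" by (rule prod_coprime_right)
  then have "nth_prime i * (\<Prod>j\<in>A. nth_prime j) dvd z"
    using insert by (intro divides_mult) auto
  then show ?case using insert.hyps by simp
qed simp

text \<open>If none of the first \<open>r\<close> primes divides \<open>z\<close>, then every prime factor of \<open>z\<close> is at least
  \<open>p\<^sub>r\<^sub>+\<^sub>1\<close>, and two of them would already make \<open>z\<close> at least its square.\<close>

lemma prime_iff_no_small_prime_dvd:
  fixes z :: int
  assumes "nth_prime (r + 1) \<le> z" "z < (nth_prime (r + 1))\<^sup>2"
  shows "prime z \<longleftrightarrow> (\<forall>i\<in>{1..r}. \<not> nth_prime i dvd z)"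
proof
  assume z: "prime z"
  show "\<forall>i\<in>{1..r}. \<not> nth_prime i dvd z"
  proof (intro ballI notI)
    fix i assume i: "i \<in> {1..r}" and "nth_prime i dvd z"
    then have "nth_prime i = z" using primes_dvd_imp_eq[OF prime_nth_prime z] by simp
    then show False using nth_prime_less[of i "r + 1"] i assms(1) by simp
  qed
next
  assume none: "\<forall>i\<in>{1..r}. \<not> nth_prime i dvd z"
  have large: "nth_prime (r + 1) \<le> q" if "prime q" "q dvd z" for q
    using prime_below_nth_prime[OF that(1), of r] none that(2) by force
  have z1: "1 < z" using assms(1) prime_gt_1_int[OF prime_nth_prime[of "r + 1"]] by simp
  then obtain q where q: "prime q" "q dvd z" using prime_divisor_exists[of z] by auto
  then obtain m where m: "z = q * m" by blast
  have m0: "0 < m" using m z1 prime_gt_0_int[OF q(1)] zero_less_mult_pos[of q m] by linarith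
  have "m = 1"
  proof (rule ccontr)
    assume "m \<noteq> 1"
    then obtain s where s: "prime s" "s dvd m" using prime_divisor_exists[of m] m0 by auto
    have "nth_prime (r + 1) \<le> m"
      using large[of s] s m m0 zdvd_imp_le[of s m] by simp
    then have "(nth_prime (r + 1))\<^sup>2 \<le> q * m"
      using large[OF q] prime_gt_0_int[OF prime_nth_prime[of "r + 1"]]
      by (simp add: power2_eq_square mult_mono)
    then show False using assms(2) m by simp
  qed
  then show "prime z" using m q(1) by simp
qed

section \<open>The residues of Z\<close>

text \<open>In the sum, only the weight with index \<open>i\<close> survives modulo \<open>p i\<close>.  For \<open>i = 1\<close> no weight
  does, as the indices start at 2.\<close>

lemma weighted_sum_cong:
  fixes p e c :: "nat \<Rightarrow> int"
  assumes self: "\<And>j. j \<in> {2..r} \<Longrightarrow> p j dvd e j"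
    and earlier: "\<And>j k. j \<in> {2..r} \<Longrightarrow> 1 \<le> k \<Longrightarrow> k < j \<Longrightarrow> [e j = 1] (mod p k)"
    and i: "i \<in> {1..r}"
  shows "[(\<Sum>j = 2..r. (e j - 1) * c j * (\<Prod>q = j + 1..r. e q))
          = (if i = 1 then 0 else - c i)] (mod p i)"
proof -
  have "[(e j - 1) * c j * (\<Prod>q = j + 1..r. e q) = (if j = i then - c i else 0)] (mod p i)"
    if j: "j \<in> {2..r}" for j
  proof (cases j i rule: linorder_cases)
    case less
    then have "e i dvd (\<Prod>q = j + 1..r. e q)" using i by (intro dvd_prodI) auto
    then have "p i dvd (\<Prod>q = j + 1..r. e q)"
      using self[of i] i j less by (auto intro: dvd_trans)
    then show ?thesis using less by (simp add: cong_0_iff)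
  next
    case equal
    have "[(\<Prod>q = i + 1..r. e q) = (\<Prod>q = i + 1..r. 1)] (mod p i)"
      using i by (intro cong_prod earlier) auto
    moreover have "[e i - 1 = 0 - 1] (mod p i)"
      using self[of i] j equal by (intro cong_diff) (auto simp: cong_0_iff)
    ultimately have "[(e i - 1) * c i * (\<Prod>q = i + 1..r. e q)
        = (0 - 1) * c i * (\<Prod>q = i + 1..r. 1)] (mod p i)"
      by (intro cong_mult cong_refl)
    then show ?thesis using equal by simp
  next
    case greater
    then have "p i dvd e j - 1"
      using earlier[of j i] i j by (simp add: cong_iff_dvd_diff)
    then show ?thesis using greater by (simp add: cong_0_iff)
  qed
  then have "[(\<Sum>j = 2..r. (e j - 1) * c j * (\<Prod>q = j + 1..r. e q))
              = (\<Sum>j = 2..r. if j = i then - c i else 0)] (mod p i)"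
    by (rule cong_sum)
  moreover have "(\<Sum>j = 2..r. if j = i then - c i else 0) = (if i = 1 then 0 else - c i)"
    using i by auto
  ultimately show ?thesis by simp
qed

lemma Z_cong:
  assumes r: "3 \<le> r"
    and sol: "\<forall>i\<in>{2..r}. nth_prime i * x i - t' i * (\<Prod>k = 1..i - 1. nth_prime k) = 1"
    and i: "i \<in> {1..r}"
  shows "[Z r x t h = (if i = 1 then - 1 else - h i)] (mod nth_prime i)"
proof -
  define e where "e j = nth_prime j * x j" for j
  define S where "S = (\<Sum>j = 2..r. (e j - 1) * (h j - 1) * (\<Prod>q = j + 1..r. e q))"
  have "{2..r} = insert r {2..r - 1}" using r by auto
  then have Z: "Z r x t h = t * (\<Prod>l = 1..r. nth_prime l) + S - 1"
    using r by (simp add: Z_def S_def e_def)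
  have earlier: "[e j = 1] (mod nth_prime k)" if "j \<in> {2..r}" "1 \<le> k" "k < j" for j k
  proof -
    have "nth_prime k dvd (\<Prod>k = 1..j - 1. nth_prime k)"
      using that by (intro dvd_prodI) auto
    moreover have "e j - 1 = t' j * (\<Prod>k = 1..j - 1. nth_prime k)"
      using sol that(1) by (auto simp: e_def algebra_simps)
    ultimately show ?thesis by (simp add: cong_iff_dvd_diff)
  qed
  have "[S = (if i = 1 then 0 else - (h i - 1))] (mod nth_prime i)"
    unfolding S_def using i earlier by (intro weighted_sum_cong) (auto simp: e_def)
  moreover have "[t * (\<Prod>l = 1..r. nth_prime l) = 0] (mod nth_prime i)"
    using i dvd_prodI[of "{1..r}" i nth_prime] by (simp add: cong_0_iff)
  ultimately have "[t * (\<Prod>l = 1..r. nth_prime l) + S - 1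
      = 0 + (if i = 1 then 0 else - (h i - 1)) - 1] (mod nth_prime i)"
    by (intro cong_diff cong_add cong_refl)
  then show ?thesis by (simp add: Z split: if_splits)
qed

section \<open>The values of Z\<close>

lemma Z_values_large:
  assumes r: "3 \<le> r"
    and sol: "\<forall>i\<in>{2..r}. nth_prime i * x i - t' i * (\<Prod>k = 1..i - 1. nth_prime k) = 1"
  shows "(\<exists>t h. (\<forall>i\<in>{2..r}. h i \<in> {1..nth_prime i - 1}) \<and> z = Z r x t h)
         \<longleftrightarrow> (\<forall>i\<in>{1..r}. \<not> nth_prime i dvd z)"
proof
  assume "\<exists>t h. (\<forall>i\<in>{2..r}. h i \<in> {1..nth_prime i - 1}) \<and> z = Z r x t h"
  then obtain t h where h: "\<forall>i\<in>{2..r}. h i \<in> {1..nth_prime i - 1}" and z: "z = Z r x t h"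
    by blast
  show "\<forall>i\<in>{1..r}. \<not> nth_prime i dvd z"
  proof (intro ballI notI)
    fix i assume i: "i \<in> {1..r}" and "nth_prime i dvd z"
    then have "nth_prime i dvd (if i = 1 then - 1 else - h i)"
      using cong_dvd_iff[OF Z_cong[OF r sol i, of t h]] z by simp
    moreover have "0 < h i \<and> h i < nth_prime i" if "i \<noteq> 1"
      using i that bspec[OF h, of i] by simp
    ultimately show False
      using nth_prime_1 zdvd_not_zless[of "h i" "nth_prime i"] by (cases "i = 1") simp_all
  qed
next
  assume none: "\<forall>i\<in>{1..r}. \<not> nth_prime i dvd z"
  define h where "h i = (- z) mod nth_prime i" for i
  have "h i \<in> {1..nth_prime i - 1}" if "i \<in> {2..r}" for i
  proof -
    have "\<not> nth_prime i dvd - z" using none that by simp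
    then have "h i \<noteq> 0" by (simp add: h_def dvd_eq_mod_eq_0)
    moreover have "0 \<le> h i" "h i < nth_prime i"
      using prime_gt_0_int[OF prime_nth_prime[of i]] by (simp_all add: h_def)
    ultimately show ?thesis by simp
  qed
  moreover have "[z = Z r x 0 h] (mod nth_prime i)" if i: "i \<in> {1..r}" for i
  proof (cases "i = 1")
    case True
    have "odd z" using none r nth_prime_1 by force
    then have "[z = - 1] (mod nth_prime i)"
      by (simp add: True nth_prime_1[simplified] cong_iff_dvd_diff)
    then show ?thesis using Z_cong[OF r sol i, of 0 h] True by (auto intro: cong_trans cong_sym)
  next
    case False
    have "[- h i = z] (mod nth_prime i)" by (simp add: h_def cong_def mod_minus_eq)
    then show ?thesis using Z_cong[OF r sol i, of 0 h] False by (auto intro: cong_trans cong_sym)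
  qed
  then have "(\<Prod>i = 1..r. nth_prime i) dvd z - Z r x 0 h"
    by (intro prod_nth_prime_dvd) (auto simp: cong_iff_dvd_diff)
  then obtain t where "z - Z r x 0 h = (\<Prod>i = 1..r. nth_prime i) * t" by blast
  then have "z = Z r x t h" using r by (simp add: Z_def algebra_simps)
  ultimately show "\<exists>t h. (\<forall>i\<in>{2..r}. h i \<in> {1..nth_prime i - 1}) \<and> z = Z r x t h" by blast
qed

lemma Z_values_1:
  "(\<exists>t h. (\<forall>i\<in>{2..1}. h i \<in> {1..nth_prime i - 1}) \<and> z = Z 1 x t h)
   \<longleftrightarrow> (\<forall>i\<in>{1..1}. \<not> nth_prime i dvd z)"
  using nth_prime_1 by (auto simp: Z_def elim!: oddE)

text \<open>Here \<open>Z 2 x t h\<close> is \<open>h\<^sub>2\<close> modulo 3, whereas for larger \<open>r\<close> it is \<open>-h\<^sub>2\<close>.\<close>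

lemma Z_values_2:
  "(\<exists>t h. (\<forall>i\<in>{2..2}. h i \<in> {1..nth_prime i - 1}) \<and> z = Z 2 x t h)
   \<longleftrightarrow> (\<forall>i\<in>{1..2}. \<not> nth_prime i dvd z)"
proof -
  have "{1..2} = {1, 2 :: nat}" by auto
  then have "(\<forall>i\<in>{1..2}. \<not> nth_prime i dvd z) \<longleftrightarrow> \<not> 2 dvd z \<and> \<not> 3 dvd z"
    using nth_prime_1 nth_prime_2 by simp
  also have "\<dots> \<longleftrightarrow> (\<exists>t (h :: nat \<Rightarrow> int). 1 \<le> h 2 \<and> h 2 \<le> 2 \<and> z = 6 * t + 4 * h 2 + 3)"
  proof
    assume "\<not> 2 dvd z \<and> \<not> 3 dvd z"
    then have "\<exists>t. z = 6 * t + 4 * 1 + 3 \<or> z = 6 * t + 4 * 2 + 3" by presburger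
    then obtain t k where "k = 1 \<or> k = 2" "z = 6 * t + 4 * k + 3" by blast
    then show "\<exists>t (h :: nat \<Rightarrow> int). 1 \<le> h 2 \<and> h 2 \<le> 2 \<and> z = 6 * t + 4 * h 2 + 3"
      by (intro exI[of _ t] exI[of _ "\<lambda>_. k"]) auto
  next
    assume "\<exists>t (h :: nat \<Rightarrow> int). 1 \<le> h 2 \<and> h 2 \<le> 2 \<and> z = 6 * t + 4 * h 2 + 3"
    then obtain t k where k: "1 \<le> k" "k \<le> 2" and z: "z = 6 * t + 4 * k + 3" by blast
    from k have "k = 1 \<or> k = 2" by linarith
    then show "\<not> 2 dvd z \<and> \<not> 3 dvd z" using z by presburger
  qed
  finally show ?thesis using nth_prime_2 by (simp add: Z_def)
qed

lemma Z_values: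
  assumes "1 \<le> r"
    and "\<forall>i\<in>{2..r}. nth_prime i * x i - t' i * (\<Prod>k = 1..i - 1. nth_prime k) = 1"
  shows "(\<exists>t h. (\<forall>i\<in>{2..r}. h i \<in> {1..nth_prime i - 1}) \<and> z = Z r x t h)
         \<longleftrightarrow> (\<forall>i\<in>{1..r}. \<not> nth_prime i dvd z)"
proof -
  consider "r = 1" | "r = 2" | "3 \<le> r" using assms(1) by linarith
  then show ?thesis
  proof cases
    case 1
    show ?thesis unfolding 1 by (rule Z_values_1)
  next
    case 2
    show ?thesis unfolding 2 by (rule Z_values_2)
  next
    case 3
    then show ?thesis by (rule Z_values_large[OF _ assms(2)])
  qed
qed

theorem mainTheorem2:
  fixes r :: nat and x' t' :: "nat \<Rightarrow> int"
  assumes "r \<ge> 1"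
    and "\<forall>i\<in>{2..r}. nth_prime i * x' i - t' i * (\<Prod>k = 1..i - 1. nth_prime k) = 1"
  shows "{z. (\<exists>t h. (\<forall>i\<in>{2..r}. h i \<in> {1..nth_prime i - 1}) \<and> z = Z r x' t h)
             \<and> nth_prime (r + 1) \<le> z \<and> z < (nth_prime (r + 1))\<^sup>2}
       = {p :: int. prime p \<and> nth_prime (r + 1) \<le> p \<and> p < (nth_prime (r + 1))\<^sup>2}"
  unfolding Z_values[OF assms] using prime_iff_no_small_prime_dvd by blast

end
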